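(* Let $X$ be a countable ultrahomogeneous ultrametric space with distance set $S\subset\,]0,+\infty[$. Then $X$ is indivisible iff $X=\mathbf{B}_S$ (up to isometry) and the reverse linear ordering $>$ on $\mathbb{R}$ induces a well-ordering on $S$.
   Context: A metric space is ultrametric when $d(x,z)\leqslant\max(d(x,y),d(y,z))$ for all $x,y,z$; it is ultrahomogeneous when every isometry between finite subspaces extends to an isometry of the space onto itself. The distance set of $X$ is the set of all distances between distinct points of $X$. $\mathbf{B}_S$ is the space of all finitely supported elements of $\mathbb{Q}^S$ with distance $d(x,y)=\max\{s\in S:x(s)\neq y(s)\}$ for $x\neq y$. That $>$ induces a well-ordering on $S$ means that every nonempty subset of $S$ has a largest element. A metric space $X$ is indivisible when for every integer $k\geqslant1$ and every $\chi:X\to\{0,\dots,k-1\}$ there is a subspace $\widetilde X\subset X$ isometric to $X$ on which $\chi$ is constant. *)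

theory Defs
  imports "HOL-Analysis.Abstract_Metric_Spaces" "HOL-Library.Countable_Set"
begin

text \<open>As in the locale \<^locale>\<open>Metric_space\<close>, a metric space is a carrier set together with a
  distance function; a subspace is a subset of the carrier with the same distance function.\<close>

locale Ultrametric_space = Metric_space +
  assumes ultrametric: "\<And>x y z. \<lbrakk>x \<in> M; y \<in> M; z \<in> M\<rbrakk> \<Longrightarrow> d x z \<le> max (d x y) (d y z)"

definition isometry_betw ::
    "'a set \<Rightarrow> ('a \<Rightarrow> 'a \<Rightarrow> real) \<Rightarrow> 'b set \<Rightarrow> ('b \<Rightarrow> 'b \<Rightarrow> real) \<Rightarrow> ('a \<Rightarrow> 'b) \<Rightarrow> bool" where
  "isometry_betw M d N e f \<longleftrightarrow> bij_betw f M N \<and> (\<forall>x\<in>M. \<forall>y\<in>M. e (f x) (f y) = d x y)"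

definition isometric ::
    "'a set \<Rightarrow> ('a \<Rightarrow> 'a \<Rightarrow> real) \<Rightarrow> 'b set \<Rightarrow> ('b \<Rightarrow> 'b \<Rightarrow> real) \<Rightarrow> bool" where
  "isometric M d N e \<longleftrightarrow> (\<exists>f. isometry_betw M d N e f)"

definition ultrahomogeneous :: "'a set \<Rightarrow> ('a \<Rightarrow> 'a \<Rightarrow> real) \<Rightarrow> bool" where
  "ultrahomogeneous M d \<longleftrightarrow>
    (\<forall>A B f. finite A \<and> finite B \<and> A \<subseteq> M \<and> B \<subseteq> M \<and> isometry_betw A d B d f \<longrightarrow>
      (\<exists>g. isometry_betw M d M d g \<and> (\<forall>x\<in>A. g x = f x)))"

definition distance_set :: "'a set \<Rightarrow> ('a \<Rightarrow> 'a \<Rightarrow> real) \<Rightarrow> real set" where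
  "distance_set M d = {d x y | x y. x \<in> M \<and> y \<in> M \<and> x \<noteq> y}"

definition indivisible :: "'a set \<Rightarrow> ('a \<Rightarrow> 'a \<Rightarrow> real) \<Rightarrow> bool" where
  "indivisible M d \<longleftrightarrow>
    (\<forall>k::nat. k \<ge> 1 \<longrightarrow> (\<forall>c \<in> M \<rightarrow> {..<k}.
      \<exists>Y. Y \<subseteq> M \<and> isometric Y d M d \<and> c constant_on Y))"

text \<open>An element of \<open>\<rat>\<^sup>S\<close> is represented by its extension by \<open>0\<close> to all reals. On finitely supported
  elements the set under \<^const>\<open>Max\<close> below is finite, and it is nonempty when \<open>x \<noteq> y\<close>.\<close>

definition B_space :: "real set \<Rightarrow> (real \<Rightarrow> rat) set" where
  "B_space S = {x. finite {s. x s \<noteq> 0} \<and> {s. x s \<noteq> 0} \<subseteq> S}"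

definition B_dist :: "real set \<Rightarrow> (real \<Rightarrow> rat) \<Rightarrow> (real \<Rightarrow> rat) \<Rightarrow> real" where
  "B_dist S x y = (if x = y then 0 else Max {s \<in> S. x s \<noteq> y s})"

definition reverse_well_ordered :: "real set \<Rightarrow> bool" where
  "reverse_well_ordered S \<longleftrightarrow> (\<forall>T. T \<subseteq> S \<and> T \<noteq> {} \<longrightarrow> (\<exists>m\<in>T. \<forall>t\<in>T. t \<le> m))"

end

theory Submission
  imports Defs
begin

text \<open>
  In an ultrametric space the relation \<open>d x y \<le> r\<close> is an equivalence, and each of its classes
  splits into cells, the classes of \<open>d x y < r\<close>. The notion that carries the proof is
  infinite branching: at every distance \<open>r\<close> of the space, every closed ball of radius \<open>r\<close> has
  infinitely many cells. Nonempty countable ultrametric spaces that branch infinitely at every element of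
  \<open>S\<close> and have no other distances are all isometric, by back-and-forth
  (\<open>isometric_if_branching\<close>), and \<open>\<^bold>B\<^sub>S\<close> is one of them. So \<open>X = \<^bold>B\<^sub>S\<close> just says that \<open>X\<close> branches
  infinitely, and a copy of \<open>X\<close> inside a colour class is just a nonempty subset of that class that
  branches infinitely.

  An indivisible space defeats two specific colourings. If the balls of radius \<open>r\<close> had finitely many
  cells, homogeneity would make their number \<open>n \<ge> 2\<close> the same everywhere; give one cell of each ball
  the first colour and the others the second: a copy has \<open>n\<close> points at mutual distance \<open>r\<close>, which
  meet all \<open>n\<close> cells of a ball (\<open>branching_if_indivisible\<close>). If \<open>S\<close> contained \<open>s\<^sub>0 < s\<^sub>1 < \<dots>\<close>, fix a base
  point in each class of the relation \<open>\<exists>n. d x y \<le> s\<^sub>n\<close> and colour a point by the parity of the first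
  \<open>n\<close> for which \<open>s\<^sub>n\<close> bounds its distance to the base point: in a copy, all large \<open>n\<close> occur
  (\<open>reverse_well_ordered_if_indivisible\<close>).

  Conversely let every nonempty subset of \<open>S\<close> have a largest element and let \<open>X = A \<union> B\<close> branch
  infinitely. Call a ball large if a nonempty subset of \<open>A\<close> inside it branches infinitely at all distances up
  to its radius; a single point of \<open>A\<close> is a large ball of radius \<open>0\<close>. If every point lies in a
  large ball, then it lies in a largest one; these largest balls partition \<open>X\<close>, and the union of
  the subsets of \<open>A\<close> found in them branches infinitely at every distance
  (\<open>branching_union_of_large\<close>). Otherwise consider the points that lie in no large ball. They belong
  to \<open>B\<close>, and they branch infinitely: the same gluing argument, applied inside a ball around such
  a point, produces another such point in infinitely many of the cells of that ball
  (\<open>not_large_branching\<close>). Induction on the number of colours finishes the proof.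
\<close>

section \<open>Ultrametric spaces and isometries\<close>

context Ultrametric_space
begin

lemma isosceles:
  assumes "x \<in> M" "y \<in> M" "z \<in> M" and "d x y < d y z"
  shows "d x z = d y z"
proof -
  have "d x z \<le> max (d x y) (d y z)" "d y z \<le> max (d y x) (d x z)"
    using ultrametric assms(1-3) by blast+
  then show ?thesis
    using assms(4) commute[of x y] by linarith
qed

lemma Ultrametric_subspace:
  assumes "N \<subseteq> M"
  shows "Ultrametric_space N d"
proof -
  interpret N: Metric_space N d
    using assms by (rule subspace)
  show ?thesis
    using assms ultrametric by unfold_locales (meson subsetD)
qed

end

lemma isometric_sym:
  assumes "isometric M d N e"
  shows "isometric N e M d"
proof -
  obtain f where f: "bij_betw f M N" "\<And>x y. \<lbrakk>x \<in> M; y \<in> M\<rbrakk> \<Longrightarrow> e (f x) (f y) = d x y"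
    using assms unfolding isometric_def isometry_betw_def by blast
  have "isometry_betw N e M d (inv_into M f)"
    unfolding isometry_betw_def
  proof (intro conjI ballI)
    show "bij_betw (inv_into M f) N M"
      using f(1) by (rule bij_betw_inv_into)
  next
    fix x y assume "x \<in> N" "y \<in> N"
    then show "d (inv_into M f x) (inv_into M f y) = e x y"
      using f by (metis bij_betw_def f_inv_into_f inv_into_into)
  qed
  then show ?thesis
    unfolding isometric_def by blast
qed

lemma ultrahomogeneous_transitive:
  assumes "ultrahomogeneous M d" and "Metric_space M d" and "x \<in> M" "y \<in> M"
  obtains g where "isometry_betw M d M d g" and "g x = y"
proof -
  interpret Metric_space M d by fact
  have "isometry_betw {x} d {y} d (\<lambda>_. y)"
    using assms(3,4) by (simp add: isometry_betw_def bij_betw_def)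
  then have "\<exists>g. isometry_betw M d M d g \<and> (\<forall>a\<in>{x}. g a = y)"
    using assms(1)[unfolded ultrahomogeneous_def, rule_format, of "{x}" "{y}" "\<lambda>_. y"] assms(3,4)
    by simp
  then show thesis
    using that by blast
qed

section \<open>Infinite branching and back-and-forth\<close>

text \<open>Taking \<open>Z = M\<close> gives the intrinsic notion. The finite sets range over the larger set \<open>M\<close> because
  this form is stable under arbitrary unions of sets \<open>Z\<close>. The bound \<open>r \<le> d y' z\<close> may be imposed on all
  of \<open>F\<close>: a point \<open>z\<close> violating it lies in the cell of \<open>y'\<close>, and only finitely many cells of the
  ball around \<open>y\<close> meet \<open>F\<close>.\<close>

definition branching :: "'a set \<Rightarrow> ('a \<Rightarrow> 'a \<Rightarrow> real) \<Rightarrow> 'a set \<Rightarrow> real \<Rightarrow> bool" where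
  "branching M d Z r \<longleftrightarrow>
    (\<forall>y\<in>Z. \<forall>F. finite F \<and> F \<subseteq> M \<longrightarrow> (\<exists>y'\<in>Z. d y y' = r \<and> (\<forall>z\<in>F. r \<le> d y' z)))"

lemma branchingE:
  assumes "branching M d Z r" and "y \<in> Z" and "finite F" and "F \<subseteq> M"
  obtains y' where "y' \<in> Z" and "d y y' = r" and "\<And>z. z \<in> F \<Longrightarrow> r \<le> d y' z"
  using assms unfolding branching_def by meson

lemma branching_mono:
  assumes "branching M d Z r" and "N \<subseteq> M"
  shows "branching N d Z r"
  using assms unfolding branching_def by (meson subset_trans)

lemma branching_isometric:
  assumes "isometric M d N e" and "branching N e N r"
  shows "branching M d M r"
  unfolding branching_def
proof (intro ballI allI impI)
  obtain f where f: "bij_betw f M N" "\<And>x y. \<lbrakk>x \<in> M; y \<in> M\<rbrakk> \<Longrightarrow> e (f x) (f y) = d x y"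
    using assms(1) unfolding isometric_def isometry_betw_def by blast
  have img: "f ` M = N"
    using f(1) by (simp add: bij_betw_def)
  fix y F assume y: "y \<in> M" and F: "finite F \<and> F \<subseteq> M"
  have "f y \<in> N" "finite (f ` F)" "f ` F \<subseteq> N"
    using y F img by auto
  then obtain w where w: "w \<in> N" "e (f y) w = r" "\<And>z. z \<in> f ` F \<Longrightarrow> r \<le> e w z"
    using branchingE[OF assms(2)] by metis
  obtain y' where y': "y' \<in> M" "w = f y'"
    using w(1) img by blast
  have "d y y' = r"
    using f(2)[of y y'] y y' w(2) by simp
  moreover have "r \<le> d y' z" if "z \<in> F" for z
    using f(2)[of y' z] w(3)[of "f z"] y' F that by auto
  ultimately show "\<exists>y'\<in>M. d y y' = r \<and> (\<forall>z\<in>F. r \<le> d y' z)"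
    using y'(1) by blast
qed

definition partial_isometry ::
    "'a set \<Rightarrow> ('a \<Rightarrow> 'a \<Rightarrow> real) \<Rightarrow> 'b set \<Rightarrow> ('b \<Rightarrow> 'b \<Rightarrow> real) \<Rightarrow> ('a \<times> 'b) set \<Rightarrow> bool" where
  "partial_isometry M d N e R \<longleftrightarrow>
    R \<subseteq> M \<times> N \<and> (\<forall>a b a' b'. (a, b) \<in> R \<longrightarrow> (a', b') \<in> R \<longrightarrow> d a a' = e b b')"

lemma partial_isometry_converse:
  "partial_isometry N e M d (R\<inverse>) \<longleftrightarrow> partial_isometry M d N e R"
proof -
  have "R\<inverse> \<subseteq> N \<times> M \<longleftrightarrow> R \<subseteq> M \<times> N"
    by auto
  moreover have "(\<forall>b a b' a'. (b, a) \<in> R\<inverse> \<longrightarrow> (b', a') \<in> R\<inverse> \<longrightarrow> e b b' = d a a') \<longleftrightarrow>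
      (\<forall>a b a' b'. (a, b) \<in> R \<longrightarrow> (a', b') \<in> R \<longrightarrow> d a a' = e b b')"
    unfolding converse_iff by metis
  ultimately show ?thesis
    unfolding partial_isometry_def by simp
qed

text \<open>If \<open>a0\<close> is a point of the domain at least distance \<open>s\<close> from \<open>x\<close>, then the distances from \<open>x\<close> to the
  domain are forced by those from \<open>a0\<close>: they equal \<open>d a0 a\<close> where this exceeds \<open>s\<close>, and \<open>s\<close>
  elsewhere. So the image of \<open>x\<close> only has to be at distance \<open>s\<close> from the image of \<open>a0\<close> and in a cell
  at level \<open>s\<close> that contains no point of the range.\<close>

lemma partial_isometry_extend:
  assumes "Ultrametric_space M d" and "Ultrametric_space N e"
    and dist: "distance_set M d \<subseteq> S" and branch: "\<And>r. r \<in> S \<Longrightarrow> branching N e N r"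
    and "N \<noteq> {}"
    and R: "finite R" "partial_isometry M d N e R" and x: "x \<in> M"
  shows "\<exists>R'. finite R' \<and> partial_isometry M d N e R' \<and> R \<subseteq> R' \<and> x \<in> Domain R'"
proof -
  interpret M: Ultrametric_space M d by fact
  interpret N: Ultrametric_space N e by fact
  have sub: "a \<in> M" "b \<in> N" if "(a, b) \<in> R" for a b
    using R(2) that unfolding partial_isometry_def by auto
  have pi: "d a a' = e b b'" if "(a, b) \<in> R" "(a', b') \<in> R" for a b a' b'
    using R(2) that unfolding partial_isometry_def by blast
  have ext: ?thesis if y: "y \<in> N" and eq: "\<And>a b. (a, b) \<in> R \<Longrightarrow> d x a = e y b" for y
  proof (intro exI conjI)
    have "d a x = e b y" if "(a, b) \<in> R" for a b
      using eq[OF that] M.commute N.commute by metis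
    moreover have "d x x = 0" "e y y = 0"
      using x y by auto
    ultimately show "partial_isometry M d N e (insert (x, y) R)"
      using sub pi eq x y unfolding partial_isometry_def by auto
  qed (use R(1) in auto)
  show ?thesis
  proof (cases "R = {} \<or> x \<in> Domain R")
    case True
    then show ?thesis
    proof
      assume "R = {}"
      then show ?thesis
        using ext \<open>N \<noteq> {}\<close> by auto
    qed (use R in blast)
  next
    case False
    define s where "s = Min (d x ` Domain R)"
    have fin: "finite (d x ` Domain R)" "d x ` Domain R \<noteq> {}"
      using False R(1) by (auto simp: finite_Domain)
    then have "s \<in> d x ` Domain R"
      unfolding s_def by (rule Min_in)
    then obtain a0 b0 where ab0: "(a0, b0) \<in> R" "d x a0 = s"
      by auto
    have le: "s \<le> d x a" if "(a, b) \<in> R" for a b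
      unfolding s_def using fin(1) that by (auto intro!: Min_le)
    have "s \<in> S"
      using dist ab0 sub[OF ab0(1)] x False unfolding distance_set_def by blast
    have "b0 \<in> N" "finite (Range R)" "Range R \<subseteq> N"
      using ab0 sub R(1) by (auto simp: finite_Range)
    then obtain y where y: "y \<in> N" "e b0 y = s" "\<And>z. z \<in> Range R \<Longrightarrow> s \<le> e y z"
      using branchingE[OF branch[OF \<open>s \<in> S\<close>]] by metis
    show ?thesis
    proof (rule ext[OF y(1)])
      fix a b assume ab: "(a, b) \<in> R"
      have eq: "d a0 a = e b0 b"
        using pi[OF ab0(1) ab] .
      have y0: "e y b0 = s"
        using y(2) N.commute by metis
      have mem: "a \<in> M" "b \<in> N" "a0 \<in> M" "b0 \<in> N"
        using sub[OF ab] sub[OF ab0(1)] by auto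
      show "d x a = e y b"
      proof (cases "d a0 a > s")
        case True
        then show ?thesis
          using M.isosceles[of x a0 a] N.isosceles[of y b0 b] ab0(2) y0 eq mem x y(1) by simp
      next
        case False
        have "d x a \<le> max (d x a0) (d a0 a)" "e y b \<le> max (e y b0) (e b0 b)"
          using M.ultrametric[of x a0 a] N.ultrametric[of y b0 b] mem x y(1) by auto
        then have "d x a \<le> s" "e y b \<le> s"
          using False eq ab0(2) y0 by auto
        then show ?thesis
          using le[OF ab] y(3)[of b] ab by force
      qed
    qed
  qed
qed

text \<open>This is the analogue of Cantor's theorem on countable dense orders: extending finite partial
  isometries alternately on both sides exhausts both spaces.\<close>

theorem isometric_if_branching:
  assumes M: "Ultrametric_space M d" "countable M" "M \<noteq> {}" "distance_set M d \<subseteq> S"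
      "\<And>r. r \<in> S \<Longrightarrow> branching M d M r"
    and N: "Ultrametric_space N e" "countable N" "N \<noteq> {}" "distance_set N e \<subseteq> S"
      "\<And>r. r \<in> S \<Longrightarrow> branching N e N r"
  shows "isometric M d N e"
proof -
  interpret M: Ultrametric_space M d by fact
  interpret N: Ultrametric_space N e by fact
  obtain m :: "nat \<Rightarrow> 'a" where m: "range m = M"
    using range_from_nat_into[OF M(3,2)] by blast
  obtain n :: "nat \<Rightarrow> 'b" where n: "range n = N"
    using range_from_nat_into[OF N(3,2)] by blast
  let ?P = "\<lambda>R. finite R \<and> partial_isometry M d N e R"
  have forward: "\<exists>R'. ?P R' \<and> R \<subseteq> R' \<and> x \<in> Domain R'" if "?P R" "x \<in> M" for R x
    using partial_isometry_extend[OF M(1) N(1) M(4) N(5) N(3), of R x] that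
    by (simp add: conj_assoc)
  have backward: "\<exists>R'. ?P R' \<and> R \<subseteq> R' \<and> y \<in> Range R'" if R: "?P R" and y: "y \<in> N" for R y
  proof -
    have "finite (R\<inverse>)" "partial_isometry N e M d (R\<inverse>)"
      using R by (simp_all add: partial_isometry_converse)
    then obtain R' where "finite R'" "partial_isometry N e M d R'" "R\<inverse> \<subseteq> R'" "y \<in> Domain R'"
      using partial_isometry_extend[OF N(1) M(1) N(4) M(5) M(3) _ _ y] by metis
    then have "?P (R'\<inverse>) \<and> R \<subseteq> R'\<inverse> \<and> y \<in> Range (R'\<inverse>)"
      by (auto simp: partial_isometry_converse)
    then show ?thesis ..
  qed
  have "\<exists>R. \<forall>i. ?P (R i) \<and> (R i \<subseteq> R (Suc i) \<and> m i \<in> Domain (R (Suc i)) \<and> n i \<in> Range (R (Suc i)))"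
  proof (rule dependent_nat_choice)
    show "\<exists>R. ?P R"
      by (intro exI[of _ "{}"]) (simp add: partial_isometry_def)
  next
    fix R i assume R: "?P R"
    obtain R1 where R1: "?P R1" "R \<subseteq> R1" "m i \<in> Domain R1"
      using forward[OF R, of "m i"] m by blast
    obtain R2 where "?P R2" "R1 \<subseteq> R2" "n i \<in> Range R2"
      using backward[OF R1(1), of "n i"] n by blast
    then show "\<exists>R'. ?P R' \<and> (R \<subseteq> R' \<and> m i \<in> Domain R' \<and> n i \<in> Range R')"
      using R1 by (intro exI[of _ R2]) blast
  qed
  then obtain R where P: "\<And>i. ?P (R i)"
      and R: "\<And>i. R i \<subseteq> R (Suc i)" "\<And>i. m i \<in> Domain (R (Suc i))" "\<And>i. n i \<in> Range (R (Suc i))"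
    by blast
  have mono: "R i \<subseteq> R j" if "i \<le> j" for i j
    using R(1) that by (rule lift_Suc_mono_le)
  define U where "U = (\<Union>i. R i)"
  have U_sub: "a \<in> M" "b \<in> N" if "(a, b) \<in> U" for a b
    using P that unfolding U_def partial_isometry_def by blast+
  have U_eq: "d a a' = e b b'" if U: "(a, b) \<in> U" "(a', b') \<in> U" for a b a' b'
  proof -
    obtain i j where "(a, b) \<in> R i" "(a', b') \<in> R j"
      using U unfolding U_def by blast
    then have "(a, b) \<in> R (max i j)" "(a', b') \<in> R (max i j)"
      using mono[of i "max i j"] mono[of j "max i j"] by auto
    then show ?thesis
      using P[of "max i j"] unfolding partial_isometry_def by auto
  qed
  have "\<exists>b. (a, b) \<in> U" if "a \<in> M" for a
    using that m R(2) unfolding U_def by blast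
  then obtain f where f: "\<And>a. a \<in> M \<Longrightarrow> (a, f a) \<in> U"
    by metis
  have U_f: "b = f a" if "(a, b) \<in> U" for a b
  proof -
    have "a \<in> M" "b \<in> N"
      using U_sub that by auto
    then have "e b (f a) = 0"
      using U_eq[OF that f[of a]] by simp
    moreover have "f a \<in> N"
      using U_sub f \<open>a \<in> M\<close> by blast
    ultimately show ?thesis
      using \<open>b \<in> N\<close> by simp
  qed
  have "isometry_betw M d N e f"
    unfolding isometry_betw_def bij_betw_def
  proof (intro conjI)
    show "inj_on f M"
    proof (rule inj_onI)
      fix a a' assume a: "a \<in> M" "a' \<in> M" and "f a = f a'"
      then have "d a a' = 0"
        using U_eq[OF f[OF a(1)] f[OF a(2)]] U_sub[OF f[OF a(2)]] by simp
      then show "a = a'"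
        using a by simp
    qed
    show "f ` M = N"
    proof
      show "f ` M \<subseteq> N"
        using f U_sub by blast
      show "N \<subseteq> f ` M"
      proof
        fix b assume "b \<in> N"
        then obtain a where "(a, b) \<in> U"
          using n R(3) unfolding U_def by blast
        then show "b \<in> f ` M"
          using U_f U_sub by blast
      qed
    qed
    show "\<forall>x\<in>M. \<forall>y\<in>M. e (f x) (f y) = d x y"
      using U_eq f by metis
  qed
  then show ?thesis
    unfolding isometric_def by blast
qed

section \<open>The space of finitely supported functions\<close>

text \<open>The value of \<^const>\<open>B_dist\<close> outside the carrier can be the maximum of an empty or infinite set,
  about which nothing is known, whereas \<^locale>\<open>Metric_space\<close> asks for a distance that is nonnegative
  everywhere. Resetting it to \<open>0\<close> there changes no isometry.\<close>

definition B_metric :: "real set \<Rightarrow> (real \<Rightarrow> rat) \<Rightarrow> (real \<Rightarrow> rat) \<Rightarrow> real" where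
  "B_metric S x y = (if x \<in> B_space S \<and> y \<in> B_space S then B_dist S x y else 0)"

lemma isometric_B_metric:
  "isometric M d (B_space S) (B_metric S) \<longleftrightarrow> isometric M d (B_space S) (B_dist S)"
proof -
  have "isometry_betw M d (B_space S) (B_metric S) f \<longleftrightarrow> isometry_betw M d (B_space S) (B_dist S) f"
    for f
    unfolding isometry_betw_def B_metric_def
    by (intro conj_cong refl ball_cong) (auto dest: bij_betwE)
  then show ?thesis
    unfolding isometric_def by blast
qed

lemma B_diff:
  assumes "x \<in> B_space S" and "y \<in> B_space S"
  shows "finite {s \<in> S. x s \<noteq> y s}" and "x \<noteq> y \<Longrightarrow> {s \<in> S. x s \<noteq> y s} \<noteq> {}"
proof -
  have "{s \<in> S. x s \<noteq> y s} \<subseteq> {s. x s \<noteq> 0} \<union> {s. y s \<noteq> 0}"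
    by auto
  then show "finite {s \<in> S. x s \<noteq> y s}"
    using assms unfolding B_space_def by (auto intro: finite_subset)
next
  assume "x \<noteq> y"
  then obtain s where s: "x s \<noteq> y s"
    by blast
  then have "s \<in> {s. x s \<noteq> 0} \<union> {s. y s \<noteq> 0}"
    by auto
  then show "{s \<in> S. x s \<noteq> y s} \<noteq> {}"
    using s assms unfolding B_space_def by blast
qed

lemma B_metric_in:
  assumes "x \<in> B_space S" and "y \<in> B_space S" and "x \<noteq> y"
  shows "B_metric S x y \<in> {s \<in> S. x s \<noteq> y s}"
proof -
  have "Max {s \<in> S. x s \<noteq> y s} \<in> {s \<in> S. x s \<noteq> y s}"
    using B_diff[OF assms(1,2)] assms(3) by (intro Max_in) auto
  then show ?thesis
    using assms by (simp add: B_metric_def B_dist_def)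
qed

lemma B_metric_ge:
  assumes "x \<in> B_space S" and "y \<in> B_space S" and "s \<in> S" and "x s \<noteq> y s"
  shows "s \<le> B_metric S x y"
proof -
  have "s \<le> Max {s \<in> S. x s \<noteq> y s}"
    using B_diff[OF assms(1,2)] assms(3,4) by (intro Max_ge) auto
  moreover have "x \<noteq> y"
    using assms(4) by blast
  ultimately show ?thesis
    using assms by (simp add: B_metric_def B_dist_def)
qed

lemma Ultrametric_space_B:
  assumes "S \<subseteq> {0<..}"
  shows "Ultrametric_space (B_space S) (B_metric S)"
proof -
  have pos: "B_metric S x y > 0" if "x \<in> B_space S" "y \<in> B_space S" "x \<noteq> y" for x y
    using B_metric_in[OF that] assms by auto
  have zero: "B_metric S x y = 0" if "x = y \<or> x \<notin> B_space S \<or> y \<notin> B_space S" for x y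
    using that by (auto simp: B_metric_def B_dist_def)
  have nonneg: "0 \<le> B_metric S x y" for x y
    using pos zero by (metis less_eq_real_def)
  have ultra: "B_metric S x z \<le> max (B_metric S x y) (B_metric S y z)"
    if mem: "x \<in> B_space S" "y \<in> B_space S" "z \<in> B_space S" for x y z
  proof (cases "x = z")
    case True
    then show ?thesis
      using zero nonneg by (simp add: le_max_iff_disj)
  next
    case False
    define s where "s = B_metric S x z"
    have "s \<in> S" "x s \<noteq> z s"
      using B_metric_in[OF mem(1,3) False] unfolding s_def by auto
    then have "s \<le> B_metric S x y \<or> s \<le> B_metric S y z"
      using B_metric_ge mem by metis
    then show ?thesis
      unfolding s_def by auto
  qed
  show ?thesis
  proof
    fix x y z assume mem: "x \<in> B_space S" "y \<in> B_space S" "z \<in> B_space S"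
    show "B_metric S x z \<le> B_metric S x y + B_metric S y z"
      using ultra[OF mem] nonneg[of x y] nonneg[of y z] by linarith
  next
    show "B_metric S x y = B_metric S y x" for x y
    proof -
      have "{s \<in> S. x s \<noteq> y s} = {s \<in> S. y s \<noteq> x s}"
        by auto
      then show ?thesis
        unfolding B_metric_def B_dist_def by auto
    qed
  next
    show "B_metric S x y = 0 \<longleftrightarrow> x = y" if "x \<in> B_space S" "y \<in> B_space S" for x y
      using pos[OF that] zero[of x y] by force
  qed (use nonneg ultra in auto)
qed

lemma distance_set_B: "distance_set (B_space S) (B_metric S) \<subseteq> S"
  using B_metric_in unfolding distance_set_def by fastforce

lemma B_space_nonempty: "B_space S \<noteq> {}"
proof -
  have "(\<lambda>_. 0) \<in> B_space S"
    by (simp add: B_space_def)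
  then show ?thesis
    by blast
qed

text \<open>A finitely supported function is determined by the finite set of its nonzero entries.\<close>

lemma countable_B_space:
  assumes "countable S"
  shows "countable (B_space S)"
proof -
  define graph where "graph x = {p \<in> S \<times> (UNIV :: rat set). x (fst p) = snd p \<and> snd p \<noteq> 0}"
    for x
  have "inj_on graph (B_space S)"
  proof (rule inj_onI, rule ext)
    fix x y s assume x: "x \<in> B_space S" and y: "y \<in> B_space S" and eq: "graph x = graph y"
    have "(s, q) \<in> graph x \<longleftrightarrow> x s = q" "(s, q) \<in> graph y \<longleftrightarrow> y s = q" if "q \<noteq> 0" for q
      using x y that unfolding graph_def B_space_def by auto
    then show "x s = y s"
      using eq by metis
  qed
  moreover have "graph ` B_space S \<subseteq> {F. F \<subseteq> S \<times> UNIV \<and> finite F}"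
  proof (clarsimp, intro conjI)
    fix x assume "x \<in> B_space S"
    moreover have "graph x \<subseteq> (\<lambda>s. (s, x s)) ` {s. x s \<noteq> 0}"
      unfolding graph_def by auto
    ultimately show "finite (graph x)"
      unfolding B_space_def by (auto intro: finite_subset)
    show "graph x \<subseteq> S \<times> UNIV"
      unfolding graph_def by auto
  qed
  moreover have "countable {F. F \<subseteq> S \<times> (UNIV :: rat set) \<and> finite F}"
    using countable_Collect_finite_subset[of "S \<times> (UNIV :: rat set)"] assms
    by (auto simp: conj_commute)
  ultimately show ?thesis
    by (meson countable_image_inj_on countable_subset)
qed

text \<open>Changing the value at \<open>s\<close> to a rational number that no point of \<open>F\<close> takes there gives a point in
  a new cell; such a number exists because \<open>\<rat>\<close> is infinite.\<close>

lemma branching_B: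
  assumes "s \<in> S"
  shows "branching (B_space S) (B_metric S) (B_space S) s"
  unfolding branching_def
proof (intro ballI allI impI)
  fix x F assume x: "x \<in> B_space S" and F: "finite F \<and> F \<subseteq> B_space S"
  obtain q :: rat where q: "q \<notin> insert (x s) ((\<lambda>z. z s) ` F)"
    using ex_new_if_finite[OF infinite_UNIV_char_0, of "insert (x s) ((\<lambda>z. z s) ` F)"] F by auto
  define y where "y = x(s := q)"
  have "{t. y t \<noteq> 0} \<subseteq> insert s {t. x t \<noteq> 0}"
    unfolding y_def by auto
  then have y: "y \<in> B_space S"
    using x assms unfolding B_space_def by (auto intro: finite_subset)
  have "x \<noteq> y"
    using q unfolding y_def by (auto simp: fun_eq_iff)
  then have "B_metric S x y = s"
    using B_metric_in[OF x y] unfolding y_def by (auto split: if_splits)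
  moreover have "s \<le> B_metric S y z" if "z \<in> F" for z
    using q that F y assms by (intro B_metric_ge) (auto simp: y_def)
  ultimately show "\<exists>y\<in>B_space S. B_metric S x y = s \<and> (\<forall>z\<in>F. s \<le> B_metric S y z)"
    using y by blast
qed

section \<open>Consequences of indivisibility\<close>

text \<open>Following the inverse of the isometry from a monochromatic copy replaces the copy by a
  self-embedding, so that configurations of points can be transported into a colour class.\<close>

lemma indivisible_embedding:
  assumes "indivisible M d"
  obtains g where "\<And>x. x \<in> M \<Longrightarrow> g x \<in> M"
    and "\<And>x y. \<lbrakk>x \<in> M; y \<in> M\<rbrakk> \<Longrightarrow> d (g x) (g y) = d x y"
    and "\<And>x y. \<lbrakk>x \<in> M; y \<in> M\<rbrakk> \<Longrightarrow> P (g x) \<longleftrightarrow> P (g y)"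
proof -
  define c :: "'a \<Rightarrow> nat" where "c x = of_bool (P x)" for x
  have "c \<in> M \<rightarrow> {..<2}"
    unfolding c_def by auto
  moreover have "(2::nat) \<ge> 1"
    by simp
  ultimately obtain Y where Y: "Y \<subseteq> M" "isometric Y d M d" "c constant_on Y"
    using assms unfolding indivisible_def by meson
  obtain g where g: "bij_betw g M Y" "\<And>x y. \<lbrakk>x \<in> M; y \<in> M\<rbrakk> \<Longrightarrow> d (g x) (g y) = d x y"
    using isometric_sym[OF Y(2)] unfolding isometric_def isometry_betw_def by blast
  have gY: "g x \<in> Y" if "x \<in> M" for x
    using g(1) that by (rule bij_betwE[THEN bspec])
  show thesis
  proof (rule that)
    show "g x \<in> M" if "x \<in> M" for x
      using gY[OF that] Y(1) by blast
    show "d (g x) (g y) = d x y" if "x \<in> M" "y \<in> M" for x y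
      using g(2) that .
    show "P (g x) \<longleftrightarrow> P (g y)" if "x \<in> M" "y \<in> M" for x y
    proof -
      have "c (g x) = c (g y)"
        using Y(3) gY[OF that(1)] gY[OF that(2)] unfolding constant_on_def by metis
      then show ?thesis
        unfolding c_def by (simp add: of_bool_eq_iff)
    qed
  qed
qed

text \<open>The number of cells in a ball is handled as the largest size of a set of points at mutual
  distance \<open>r\<close>, which picks at most one point from each cell. Homogeneity carries the bound found
  at one point to all others.\<close>

lemma branching_if_indivisible:
  assumes "Ultrametric_space M d" and hom: "ultrahomogeneous M d" and ind: "indivisible M d"
    and r: "r \<in> distance_set M d"
  shows "branching M d M r"
proof (rule ccontr)
  interpret Ultrametric_space M d by fact
  assume "\<not> branching M d M r"
  then obtain y0 F where y0: "y0 \<in> M" and F: "finite F" "F \<subseteq> M"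
    and near: "\<And>y. \<lbrakk>y \<in> M; d y0 y = r\<rbrakk> \<Longrightarrow> \<exists>z\<in>F. d y z < r"
    unfolding branching_def by (meson not_le)
  obtain u v where uv: "u \<in> M" "v \<in> M" "u \<noteq> v" "d u v = r"
    using r unfolding distance_set_def by blast
  have "r > 0"
    using uv nonneg[of u v] zero[of u v] by linarith
  define equilateral where "equilateral E \<longleftrightarrow>
      finite E \<and> E \<subseteq> M \<and> (\<forall>a\<in>E. \<forall>b\<in>E. a \<noteq> b \<longrightarrow> d a b = r)" for E
  have equilateral_image: "equilateral (g ` E) \<and> card (g ` E) = card E"
    if g: "\<And>x. x \<in> M \<Longrightarrow> g x \<in> M" "\<And>x y. \<lbrakk>x \<in> M; y \<in> M\<rbrakk> \<Longrightarrow> d (g x) (g y) = d x y"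
      and E: "equilateral E" for g E
  proof
    have sub: "E \<subseteq> M"
      using E unfolding equilateral_def by blast
    have "d (g a) (g b) = r" if "a \<in> E" "b \<in> E" "g a \<noteq> g b" for a b
    proof -
      have "a \<noteq> b" "a \<in> M" "b \<in> M"
        using that sub by auto
      then show ?thesis
        using g(2)[of a b] E that unfolding equilateral_def by auto
    qed
    then show "equilateral (g ` E)"
      using E g(1) sub unfolding equilateral_def by auto
    have "inj_on g E"
    proof (rule inj_onI)
      fix a b assume ab: "a \<in> E" "b \<in> E" "g a = g b"
      then have mem: "a \<in> M" "b \<in> M"
        using sub by auto
      then have "d a b = 0"
        using g(2)[of a b] g(1)[of b] ab(3) by simp
      then show "a = b"
        using mem by simp
    qed
    then show "card (g ` E) = card E"
      by (rule card_image)
  qed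
  have bound_y0: "card E \<le> Suc (card F)" if E: "equilateral E" "y0 \<in> E" for E
  proof -
    have "\<exists>z\<in>F. d e z < r" if "e \<in> E - {y0}" for e
    proof (rule near)
      show "e \<in> M" "d y0 e = r"
        using E that unfolding equilateral_def by auto
    qed
    then obtain h where h: "\<And>e. e \<in> E - {y0} \<Longrightarrow> h e \<in> F \<and> d e (h e) < r"
      by metis
    have "inj_on h (E - {y0})"
    proof (rule inj_onI, rule ccontr)
      fix a b assume a: "a \<in> E - {y0}" and b: "b \<in> E - {y0}" and "h a = h b" "a \<noteq> b"
      then have "d a b = r" "a \<in> M" "b \<in> M" "h a \<in> M" "d a (h a) < r" "d (h a) b < r"
        using E h[OF a] h[OF b] F commute[of b "h b"] unfolding equilateral_def by auto
      then show False
        using ultrametric[of a "h a" b] by linarith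
    qed
    moreover have "h ` (E - {y0}) \<subseteq> F"
      using h by blast
    ultimately have "card (E - {y0}) \<le> card F"
      using F(1) by (rule card_inj_on_le)
    then show ?thesis
      using E unfolding equilateral_def by simp
  qed
  have bound: "card E \<le> Suc (card F)" if E: "equilateral E" for E
  proof (cases "E = {}")
    case False
    then obtain a where a: "a \<in> E" "a \<in> M"
      using E unfolding equilateral_def by blast
    obtain g where g: "isometry_betw M d M d g" "g a = y0"
      using ultrahomogeneous_transitive[OF hom Metric_space_axioms a(2) y0] by blast
    have "equilateral (g ` E) \<and> card (g ` E) = card E"
      using g(1) E by (intro equilateral_image) (auto simp: isometry_betw_def dest: bij_betwE)
    then show ?thesis
      using bound_y0[of "g ` E"] a(1) g(2) by force
  qed simp
  have "equilateral {u, v}"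
    using uv commute[of v u] unfolding equilateral_def by auto
  then obtain E where E: "equilateral E" and max: "\<And>E'. equilateral E' \<Longrightarrow> card E' \<le> card E"
    using ex_has_greatest_nat[of equilateral "{u, v}" card "Suc (Suc (card F))"] bound
    by (metis less_Suc_eq_le)
  have "card E \<ge> 2"
    using max[OF \<open>equilateral {u, v}\<close>] uv(3) by simp
  \<comment> \<open>\<open>p y\<close> depends only on the closed ball around \<open>y\<close>; the cell of \<open>p y\<close> gets its own colour.\<close>
  define p where "p y = (SOME q. q \<in> M \<and> d y q \<le> r)" for y
  have p: "p y \<in> M" "d y (p y) \<le> r" if "y \<in> M" for y
  proof -
    have "y \<in> M \<and> d y y \<le> r"
      using that \<open>r > 0\<close> by simp
    then have "p y \<in> M \<and> d y (p y) \<le> r"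
      unfolding p_def by (rule someI)
    then show "p y \<in> M" "d y (p y) \<le> r"
      by auto
  qed
  have p_cong: "p y = p y'" if y: "y \<in> M" "y' \<in> M" "d y y' \<le> r" for y y'
  proof -
    have "q \<in> M \<and> d y q \<le> r \<longleftrightarrow> q \<in> M \<and> d y' q \<le> r" for q
      using y ultrametric[of y y' q] ultrametric[of y' y q] commute[of y y'] by auto
    then show ?thesis
      unfolding p_def by simp
  qed
  obtain g where g: "\<And>x. x \<in> M \<Longrightarrow> g x \<in> M" "\<And>x y. \<lbrakk>x \<in> M; y \<in> M\<rbrakk> \<Longrightarrow> d (g x) (g y) = d x y"
    and const: "\<And>x y. \<lbrakk>x \<in> M; y \<in> M\<rbrakk> \<Longrightarrow> d (g x) (p (g x)) < r \<longleftrightarrow> d (g y) (p (g y)) < r"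
    using indivisible_embedding[OF ind, of "\<lambda>y. d y (p y) < r"] by blast
  define G where "G = g ` E"
  have G: "equilateral G" "card G = card E"
    using equilateral_image[OF g E] unfolding G_def by auto
  have GM: "G \<subseteq> M" and G_dist: "\<And>a b. \<lbrakk>a \<in> G; b \<in> G; a \<noteq> b\<rbrakk> \<Longrightarrow> d a b = r" and "finite G"
    using G(1) unfolding equilateral_def by auto
  have G_const: "d a (p a) < r \<longleftrightarrow> d b (p b) < r" if "a \<in> G" "b \<in> G" for a b
    using const that E unfolding G_def equilateral_def by blast
  have G_p: "p a = p b" if "a \<in> G" "b \<in> G" for a b
    using p_cong[of a b] G_dist[of a b] GM that by (cases "a = b") auto
  obtain a where a: "a \<in> G"
    using G(2) \<open>card E \<ge> 2\<close> by fastforce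
  \<comment> \<open>By maximality, the embedded set \<open>G\<close> meets the cell of the representative.\<close>
  have "\<exists>e\<in>G. d e (p a) < r"
  proof (rule ccontr)
    assume "\<not> (\<exists>e\<in>G. d e (p a) < r)"
    then have eq: "d e (p a) = r" if "e \<in> G" for e
      using p(2)[of e] G_p[OF that a] that GM by force
    then have "p a \<notin> G"
      using p(1)[of a] a GM \<open>r > 0\<close> by force
    have eq': "d (p a) e = r" if "e \<in> G" for e
      using eq[OF that] commute[of "p a" e] by simp
    have "p a \<in> M"
      using p(1) a GM by blast
    then have "equilateral (insert (p a) G)"
      using eq eq' G_dist GM \<open>finite G\<close> unfolding equilateral_def by auto
    then have "card (insert (p a) G) \<le> card E"
      by (rule max)
    then show False
      using \<open>p a \<notin> G\<close> \<open>finite G\<close> G(2) by simp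
  qed
  then obtain e where e: "e \<in> G" "d e (p a) < r"
    by blast
  have "G \<noteq> {e}"
    using G(2) \<open>card E \<ge> 2\<close> by auto
  then obtain e' where e': "e' \<in> G" "e' \<noteq> e"
    using e(1) by blast
  have "d e (p a) < d e' e"
    using e(2) G_dist[OF e'(1) e(1) e'(2)] by simp
  then have "d (p a) e' = d e e'"
    using isosceles[of "p a" e e'] commute e e' GM p(1)[of a] a by (metis subsetD)
  then have "\<not> d e' (p a) < r"
    using G_dist[OF e(1) e'(1)] e'(2) commute[of e' "p a"] by simp
  then show False
    using G_const[OF e(1) e'(1)] e(2) G_p[OF e(1) a] G_p[OF e'(1) a] by simp
qed

text \<open>The parity colouring works because a point at distance \<open>s n\<close> from \<open>g x\<close> is also at distance \<open>s n\<close>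
  from the base point once \<open>s n\<close> exceeds the distance between \<open>g x\<close> and the base point.\<close>

lemma reverse_well_ordered_if_indivisible:
  assumes "Ultrametric_space M d" and hom: "ultrahomogeneous M d" and ind: "indivisible M d"
  shows "reverse_well_ordered (distance_set M d)"
proof (rule ccontr)
  interpret Ultrametric_space M d by fact
  assume "\<not> reverse_well_ordered (distance_set M d)"
  then obtain T where T: "T \<subseteq> distance_set M d" "T \<noteq> {}" "\<And>t. t \<in> T \<Longrightarrow> \<exists>t'\<in>T. t < t'"
    unfolding reverse_well_ordered_def by (meson not_le)
  have "\<exists>s. \<forall>n::nat. s n \<in> T \<and> s n < s (Suc n)"
    using T by (intro dependent_nat_choice) auto
  then obtain s :: "nat \<Rightarrow> real" where s: "\<And>n. s n \<in> T" "strict_mono s"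
    unfolding strict_mono_Suc_iff by blast
  have s_less: "s m < s n \<longleftrightarrow> m < n" for m n
    using s(2) by (rule strict_mono_less)
  have s_nonneg: "0 \<le> s n" for n
    using s(1)[of n] T(1) nonneg unfolding distance_set_def by auto
  define a where "a y = (SOME q. q \<in> M \<and> (\<exists>n. d y q \<le> s n))" for y
  define level where "level y = (LEAST n. d y (a y) \<le> s n)" for y
  have a: "a y \<in> M" "\<exists>n. d y (a y) \<le> s n" if "y \<in> M" for y
  proof -
    have "y \<in> M \<and> (\<exists>n. d y y \<le> s n)"
      using that s_nonneg by simp
    then have "a y \<in> M \<and> (\<exists>n. d y (a y) \<le> s n)"
      unfolding a_def by (rule someI)
    then show "a y \<in> M" "\<exists>n. d y (a y) \<le> s n"
      by auto
  qed
  have step: "\<exists>n. d y' q \<le> s n" if "y \<in> M" "y' \<in> M" "q \<in> M" "d y' y \<le> s m" "d y q \<le> s k" for y y' q m k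
  proof
    have "s m \<le> s (max m k)" "s k \<le> s (max m k)"
      using s_less by (metis max.cobounded1 max.cobounded2 not_le)+
    then show "d y' q \<le> s (max m k)"
      using ultrametric[of y' y q] that by linarith
  qed
  have a_cong: "a y = a y'" if "y \<in> M" "y' \<in> M" "d y y' \<le> s m" for y y' m
  proof -
    have "d y' y \<le> s m"
      using that(3) commute[of y' y] by simp
    then have "q \<in> M \<and> (\<exists>n. d y q \<le> s n) \<longleftrightarrow> q \<in> M \<and> (\<exists>n. d y' q \<le> s n)" for q
      using step[OF that(1,2)] step[OF that(2,1)] that(3) by blast
    then show ?thesis
      unfolding a_def by simp
  qed
  obtain g where g: "\<And>x. x \<in> M \<Longrightarrow> g x \<in> M" "\<And>x y. \<lbrakk>x \<in> M; y \<in> M\<rbrakk> \<Longrightarrow> d (g x) (g y) = d x y"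
    and const: "\<And>x y. \<lbrakk>x \<in> M; y \<in> M\<rbrakk> \<Longrightarrow> even (level (g x)) \<longleftrightarrow> even (level (g y))"
    using indivisible_embedding[OF ind, of "\<lambda>y. even (level y)"] by blast
  obtain x where x: "x \<in> M"
    using s(1) T(1) unfolding distance_set_def by blast
  obtain m where m: "d (g x) (a (g x)) \<le> s m"
    using a(2)[OF g(1)[OF x]] by blast
  have ex: "\<exists>y\<in>M. level (g y) = n" if "m < n" for n
  proof -
    have "s n \<in> distance_set M d"
      using s(1) T(1) by blast
    then obtain y where y: "y \<in> M" "d x y = s n"
      using branchingE[OF branching_if_indivisible[OF assms(1) hom ind], of "s n" x "{}"] x by blast
    have gy: "d (g x) (g y) = s n"
      using g(2) x y by simp
    have eq: "a (g y) = a (g x)"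
      using a_cong[of "g x" "g y" n] gy g(1) x y(1) by simp
    have "d (a (g x)) (g x) < d (g x) (g y)"
      using m gy s_less[of m n] that commute[of "g x" "a (g x)"] by simp
    then have "d (a (g x)) (g y) = s n"
      using isosceles[of "a (g x)" "g x" "g y"] a(1) g(1) x y(1) gy by simp
    then have "d (g y) (a (g y)) = s n"
      using eq commute[of "g y"] by simp
    then have "level (g y) = n"
      unfolding level_def using s_less by (intro Least_equality) (auto simp: not_less[symmetric])
    then show ?thesis
      using y(1) by blast
  qed
  obtain y y' where "y \<in> M" "level (g y) = Suc m" "y' \<in> M" "level (g y') = Suc (Suc m)"
    using ex[of "Suc m"] ex[of "Suc (Suc m)"] by auto
  then show False
    using const[of y y'] by simp
qed

section \<open>Monochromatic branching subsets\<close>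

text \<open>Radius \<open>0\<close> is meaningful: for \<open>S \<subseteq> {0<..}\<close> and \<open>x \<in> M\<close> the ball of radius \<open>0\<close> around
  \<open>x\<close> is large exactly if \<open>x \<in> A\<close>. Including \<open>0\<close>
  among the radii therefore treats points of \<open>A\<close> and balls uniformly.\<close>

definition large :: "'a set \<Rightarrow> ('a \<Rightarrow> 'a \<Rightarrow> real) \<Rightarrow> real set \<Rightarrow> 'a set \<Rightarrow> 'a \<Rightarrow> real \<Rightarrow> bool" where
  "large M d S A x s \<longleftrightarrow> (\<exists>Z. Z \<subseteq> A \<inter> M \<and> Z \<noteq> {} \<and> (\<forall>z\<in>Z. d x z \<le> s) \<and>
    (\<forall>r\<in>S. r \<le> s \<longrightarrow> branching M d Z r))"

lemma reverse_well_ordered_insert_0: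
  assumes "reverse_well_ordered S" and "S \<subseteq> {0<..}"
  shows "reverse_well_ordered (insert 0 S)"
  unfolding reverse_well_ordered_def
proof (intro allI impI)
  fix T assume T: "T \<subseteq> insert 0 S \<and> T \<noteq> {}"
  show "\<exists>m\<in>T. \<forall>t\<in>T. t \<le> m"
  proof (cases "T \<inter> S = {}")
    case True
    then have "T = {0}"
      using T by blast
    then show ?thesis
      by simp
  next
    case False
    then have "\<exists>m\<in>T \<inter> S. \<forall>t\<in>T \<inter> S. t \<le> m"
      using assms(1) unfolding reverse_well_ordered_def by simp
    then obtain m where m: "m \<in> T \<inter> S" "\<And>t. t \<in> T \<inter> S \<Longrightarrow> t \<le> m"
      by blast
    then have "t \<le> m" if "t \<in> T" for t
    proof (cases "t = 0")
      case True
      then show ?thesis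
        using m(1) assms(2) by (auto simp: less_imp_le)
    qed (use that T m(2) in blast)
    then show ?thesis
      using m(1) by blast
  qed
qed

context Ultrametric_space
begin

lemma large_cong_imp:
  assumes "x \<in> M" "y \<in> M" "d x y \<le> s" and "large M d S A x s"
  shows "large M d S A y s"
proof -
  obtain Z where Z: "Z \<subseteq> A \<inter> M" "Z \<noteq> {}" "\<forall>z\<in>Z. d x z \<le> s"
    "\<forall>r\<in>S. r \<le> s \<longrightarrow> branching M d Z r"
    using assms(4) unfolding large_def by blast
  have "d y z \<le> s" if "z \<in> Z" for z
    using ultrametric[of y x z] assms(1-3) Z(1,3) that commute[of x y] by fastforce
  then show ?thesis
    using Z unfolding large_def by blast
qed

text \<open>For each point of \<open>D\<close> take the largest radius \<open>t\<close> at which its ball is large, which exists by the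
  reverse well-ordering. At a distance \<open>r \<le> t\<close> the union branches because the set inside that ball
  does. At \<open>r > t\<close>, branching of \<open>D\<close> gives a point \<open>y'\<close> in a new cell. The largest large ball around
  \<open>y'\<close> has radius less than \<open>r\<close>, since otherwise it would contain \<open>y\<close> as well and contradict the choice
  of \<open>t\<close>; so it lies in the new cell and contributes a point there.\<close>

lemma branching_union_of_large:
  assumes S: "reverse_well_ordered S" "S \<subseteq> {0<..}" and L: "L \<subseteq> S"
    and D: "D \<subseteq> M" "D \<noteq> {}" "\<And>r. r \<in> L \<Longrightarrow> branching M d D r"
    and large: "\<And>y. y \<in> D \<Longrightarrow> \<exists>t\<in>insert 0 L. large M d S A y t"
  shows "\<exists>Z. Z \<subseteq> A \<inter> M \<and> Z \<noteq> {} \<and> (\<forall>r\<in>L. branching M d Z r) \<and>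
    (\<forall>z\<in>Z. \<exists>y\<in>D. \<exists>t\<in>insert 0 L. d y z \<le> t)"
proof -
  have "\<exists>t\<in>insert 0 L. large M d S A y t \<and> (\<forall>u\<in>insert 0 L. large M d S A y u \<longrightarrow> u \<le> t)"
    if "y \<in> D" for y
  proof -
    let ?T = "{t \<in> insert 0 L. large M d S A y t}"
    have "?T \<subseteq> insert 0 S \<and> ?T \<noteq> {}"
      using large[OF that] L by blast
    then have "\<exists>m\<in>?T. \<forall>t\<in>?T. t \<le> m"
      using reverse_well_ordered_insert_0[OF S] unfolding reverse_well_ordered_def by blast
    then show ?thesis
      by blast
  qed
  then obtain t where t: "\<And>y. y \<in> D \<Longrightarrow> t y \<in> insert 0 L" "\<And>y. y \<in> D \<Longrightarrow> large M d S A y (t y)"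
    and t_max: "\<And>y u. \<lbrakk>y \<in> D; u \<in> insert 0 L; large M d S A y u\<rbrakk> \<Longrightarrow> u \<le> t y"
    by metis
  have "\<exists>Z. \<forall>y\<in>D. Z y \<subseteq> A \<inter> M \<and> Z y \<noteq> {} \<and> (\<forall>z\<in>Z y. d y z \<le> t y) \<and>
      (\<forall>r\<in>S. r \<le> t y \<longrightarrow> branching M d (Z y) r)"
    using t(2) unfolding large_def by (intro bchoice) blast
  then obtain Z where Z: "\<And>y. y \<in> D \<Longrightarrow> Z y \<subseteq> A \<inter> M" "\<And>y. y \<in> D \<Longrightarrow> Z y \<noteq> {}"
    and Z_near: "\<And>y z. \<lbrakk>y \<in> D; z \<in> Z y\<rbrakk> \<Longrightarrow> d y z \<le> t y"
    and Z_branch: "\<And>y r. \<lbrakk>y \<in> D; r \<in> S; r \<le> t y\<rbrakk> \<Longrightarrow> branching M d (Z y) r"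
    by metis
  show ?thesis
  proof (intro exI conjI ballI)
    show "(\<Union>y\<in>D. Z y) \<subseteq> A \<inter> M" "(\<Union>y\<in>D. Z y) \<noteq> {}"
      using Z D(2) by auto
    show "\<exists>y\<in>D. \<exists>u\<in>insert 0 L. d y z \<le> u" if "z \<in> (\<Union>y\<in>D. Z y)" for z
      using that Z_near t(1) by blast
    show "branching M d (\<Union>y\<in>D. Z y) r" if r: "r \<in> L" for r
      unfolding branching_def
    proof (intro ballI allI impI)
      fix z F assume "z \<in> (\<Union>y\<in>D. Z y)" and F: "finite F \<and> F \<subseteq> M"
      then obtain y where y: "y \<in> D" "z \<in> Z y"
        by blast
      have mem: "y \<in> M" "z \<in> M"
        using y D(1) Z(1) by auto
      show "\<exists>w\<in>\<Union>y\<in>D. Z y. d z w = r \<and> (\<forall>x\<in>F. r \<le> d w x)"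
      proof (cases "r \<le> t y")
        case True
        then have "branching M d (Z y) r"
          using Z_branch y(1) r L by blast
        then obtain w where "w \<in> Z y" "d z w = r" "\<And>x. x \<in> F \<Longrightarrow> r \<le> d w x"
          using branchingE y(2) F by metis
        then show ?thesis
          using y(1) by blast
      next
        case False
        obtain y' where y': "y' \<in> D" "d y y' = r" "\<And>x. x \<in> insert z F \<Longrightarrow> r \<le> d y' x"
          using branchingE[OF D(3)[OF r] y(1), of "insert z F"] F mem(2) by auto
        have "y' \<in> M"
          using y'(1) D(1) by blast
        have "t y' < r"
        proof (rule ccontr)
          assume "\<not> t y' < r"
          then have "d y' y \<le> t y'"
            using y'(2) commute[of y y'] by simp
          then have "large M d S A y (t y')"
            using large_cong_imp t(2) y'(1) \<open>y' \<in> M\<close> mem(1) by blast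
          then show False
            using t_max[OF y(1) t(1)[OF y'(1)]] \<open>\<not> t y' < r\<close> False by linarith
        qed
        obtain w where w: "w \<in> Z y'"
          using Z(2)[OF y'(1)] by blast
        have "w \<in> M" "d y' w < r"
          using w Z(1)[OF y'(1)] Z_near[OF y'(1) w] \<open>t y' < r\<close> by auto
        have far: "r \<le> d w x" if "x \<in> insert z F" for x
        proof -
          have "x \<in> M"
            using that F mem(2) by blast
          then show ?thesis
            using ultrametric[of y' w x] \<open>y' \<in> M\<close> \<open>w \<in> M\<close> \<open>d y' w < r\<close> y'(3)[OF that] by linarith
        qed
        have "d y z < r"
          using Z_near[OF y] False by simp
        then have "d z y' \<le> r"
          using ultrametric[of z y y'] commute[of z y] y'(2) mem \<open>y' \<in> M\<close> by simp
        then have "d z w \<le> r"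
          using ultrametric[of z y' w] mem \<open>y' \<in> M\<close> \<open>w \<in> M\<close> \<open>d y' w < r\<close> by linarith
        then have "d z w = r"
          using far[of z] commute[of z w] by simp
        then show ?thesis
          using far w y'(1) by blast
      qed
    qed
  qed
qed

text \<open>If this fails, every point in the union \<open>D\<close> of those cells of the ball around \<open>x\<close> that avoid \<open>F\<close>
  and \<open>x\<close> has a large ball of radius less than \<open>s\<close>, and gluing applies to \<open>D\<close>.
  Removing finitely many cells leaves infinitely many, so the glued set shows that the ball around \<open>x\<close> is large.\<close>

lemma not_large_branching:
  assumes S: "reverse_well_ordered S" "S \<subseteq> {0<..}" "\<And>r. r \<in> S \<Longrightarrow> branching M d M r"
    and x: "x \<in> M" and s: "s \<in> S" and not_large: "\<not> large M d S A x s" and F: "finite F" "F \<subseteq> M"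
  shows "\<exists>y\<in>M. d x y = s \<and> (\<forall>z\<in>F. s \<le> d y z) \<and>
    (\<forall>t\<in>insert 0 S. t < s \<longrightarrow> \<not> large M d S A y t)"
proof (rule ccontr)
  assume no: "\<not> ?thesis"
  define D where "D = {y \<in> M. d x y = s \<and> (\<forall>z\<in>F. s \<le> d y z)}"
  define L where "L = {r \<in> S. r \<le> s}"
  have D_large: "\<exists>t\<in>insert 0 L. large M d S A y t" if "y \<in> D" for y
  proof -
    have "y \<in> M" "d x y = s" "\<forall>z\<in>F. s \<le> d y z"
      using that unfolding D_def by auto
    then have "\<exists>t\<in>insert 0 S. t < s \<and> large M d S A y t"
      using no by metis
    then show ?thesis
      unfolding L_def by auto
  qed
  have "D \<noteq> {}"
  proof -
    obtain y where "y \<in> M" "d x y = s" "\<And>z. z \<in> F \<Longrightarrow> s \<le> d y z"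
      using branchingE[OF S(3)[OF s] x F] by metis
    then have "y \<in> D"
      unfolding D_def by simp
    then show ?thesis
      by blast
  qed
  have D_branch: "branching M d D r" if "r \<in> L" for r
    unfolding branching_def
  proof (intro ballI allI impI)
    fix y G assume "y \<in> D" and G: "finite G \<and> G \<subseteq> M"
    then have y: "y \<in> M" "d x y = s" "\<And>z. z \<in> F \<Longrightarrow> s \<le> d y z"
      unfolding D_def by auto
    have r: "r \<in> S" "r \<le> s"
      using that unfolding L_def by auto
    obtain y' where y': "y' \<in> M" "d y y' = r" "\<And>z. z \<in> insert x (F \<union> G) \<Longrightarrow> r \<le> d y' z"
      using branchingE[OF S(3)[OF r(1)] y(1), of "insert x (F \<union> G)"] F G x by auto
    have far: "s \<le> d y' z" if z: "z \<in> insert x F" for z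
    proof (cases "r = s")
      case True
      then show ?thesis
        using y'(3) z by blast
    next
      case False
      have "s \<le> d y z" "z \<in> M"
        using y z commute[of x y] x F by auto
      then show ?thesis
        using ultrametric[of y y' z] y(1) y'(1,2) r(2) False by linarith
    qed
    have "d x y' \<le> s"
      using ultrametric[of x y y'] x y y' r(2) by simp
    then have "d x y' = s"
      using far[of x] commute[of x y'] by simp
    then have "y' \<in> D"
      using y'(1) far unfolding D_def by blast
    then show "\<exists>y'\<in>D. d y y' = r \<and> (\<forall>z\<in>G. r \<le> d y' z)"
      using y' by blast
  qed
  have "L \<subseteq> S" "D \<subseteq> M"
    unfolding L_def D_def by auto
  then obtain Z where Z: "Z \<subseteq> A \<inter> M" "Z \<noteq> {}" "\<forall>r\<in>L. branching M d Z r"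
    and Z_near: "\<forall>z\<in>Z. \<exists>y\<in>D. \<exists>t\<in>insert 0 L. d y z \<le> t"
    using branching_union_of_large[OF S(1,2) _ _ \<open>D \<noteq> {}\<close> D_branch D_large] by metis
  have "d x z \<le> s" if z: "z \<in> Z" for z
  proof -
    obtain y t where y: "y \<in> D" "t \<in> insert 0 L" "d y z \<le> t"
      using Z_near z by blast
    have "t \<le> s"
      using y(2) s S(2) unfolding L_def by auto
    moreover have "y \<in> M" "d x y = s" "z \<in> M"
      using y(1) z Z(1) unfolding D_def by auto
    ultimately show ?thesis
      using ultrametric[of x y z] x y(3) by simp
  qed
  then have "large M d S A x s"
    using Z unfolding large_def L_def by blast
  then show False
    using not_large by blast
qed

text \<open>The set for the second alternative consists of the points that lie in no large ball. A new point
  obtained at distance \<open>s\<close> inherits from \<open>x\<close> that its balls of radius at least \<open>s\<close> are not large,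
  because they are the same balls.\<close>

lemma monochromatic_branching_2:
  assumes S: "reverse_well_ordered S" "S \<subseteq> {0<..}" "\<And>r. r \<in> S \<Longrightarrow> branching M d M r"
    and "M \<noteq> {}"
  obtains Z where "Z \<subseteq> M" "Z \<noteq> {}" "\<And>r. r \<in> S \<Longrightarrow> branching M d Z r" "Z \<subseteq> A \<or> Z \<inter> A = {}"
proof -
  define G where "G = {y \<in> M. \<forall>t\<in>insert 0 S. \<not> large M d S A y t}"
  show thesis
  proof (cases "G = {}")
    case True
    then have "\<exists>t\<in>insert 0 S. large M d S A y t" if "y \<in> M" for y
      using that unfolding G_def by blast
    then obtain Z where "Z \<subseteq> A \<inter> M" "Z \<noteq> {}" "\<forall>r\<in>S. branching M d Z r"
      using branching_union_of_large[OF S(1,2) order_refl order_refl \<open>M \<noteq> {}\<close> S(3)] by metis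
    then show thesis
      using that[of Z] by blast
  next
    case False
    have "branching M d G s" if s: "s \<in> S" for s
      unfolding branching_def
    proof (intro ballI allI impI)
      fix x F assume "x \<in> G" and F: "finite F \<and> F \<subseteq> M"
      then have x: "x \<in> M" "\<And>t. t \<in> insert 0 S \<Longrightarrow> \<not> large M d S A x t"
        unfolding G_def by auto
      obtain y where y: "y \<in> M" "d x y = s" "\<And>z. z \<in> F \<Longrightarrow> s \<le> d y z"
        and y_small: "\<And>t. \<lbrakk>t \<in> insert 0 S; t < s\<rbrakk> \<Longrightarrow> \<not> large M d S A y t"
        using not_large_branching[OF S x(1) s, of A F] x(2)[of s] s F by auto
      have "\<not> large M d S A y t" if t: "t \<in> insert 0 S" for t
      proof (cases "t < s")
        case False
        then have "d y x \<le> t"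
          using y(2) commute[of x y] by simp
        then show ?thesis
          using large_cong_imp[of y x t] x y(1) t by blast
      qed (use y_small t in blast)
      then have "y \<in> G"
        using y(1) unfolding G_def by blast
      then show "\<exists>y\<in>G. d x y = s \<and> (\<forall>z\<in>F. s \<le> d y z)"
        using y by blast
    qed
    moreover have "G \<inter> A = {}"
    proof -
      have "large M d S A x 0" if "x \<in> M" "x \<in> A" for x
      proof -
        have "\<not> r \<le> 0" if "r \<in> S" for r
          using S(2) that by auto
        then show ?thesis
          using that unfolding large_def by (intro exI[of _ "{x}"]) auto
      qed
      then show ?thesis
        unfolding G_def by blast
    qed
    moreover have "G \<subseteq> M"
      unfolding G_def by blast
    ultimately show thesis
      using that[of G] False by blast
  qed
qed

end

lemma monochromatic_branching:
  fixes c :: "'a \<Rightarrow> nat"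
  assumes S: "reverse_well_ordered S" "S \<subseteq> {0<..}"
    and "Ultrametric_space M d" and "\<And>r. r \<in> S \<Longrightarrow> branching M d M r" and "M \<noteq> {}"
    and "c ` M \<subseteq> {..<k}"
  shows "\<exists>Z. Z \<subseteq> M \<and> Z \<noteq> {} \<and> (\<forall>r\<in>S. branching Z d Z r) \<and> c constant_on Z"
  using assms(3-6)
proof (induction k arbitrary: M)
  case 0
  then show ?case
    by auto
next
  case (Suc k)
  interpret Ultrametric_space M d by fact
  obtain Z where Z: "Z \<subseteq> M" "Z \<noteq> {}" "\<And>r. r \<in> S \<Longrightarrow> branching M d Z r"
    "Z \<subseteq> {x. c x = k} \<or> Z \<inter> {x. c x = k} = {}"
    using monochromatic_branching_2[OF S Suc.prems(2,3), of "{x. c x = k}"] by blast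
  have Z_branch: "branching Z d Z r" if "r \<in> S" for r
    using Z(3)[OF that] Z(1) by (rule branching_mono)
  show ?case
  proof (cases "Z \<subseteq> {x. c x = k}")
    case True
    then have "c constant_on Z"
      unfolding constant_on_def by blast
    then show ?thesis
      using Z(1,2) Z_branch by blast
  next
    case False
    have "c x < k" if "x \<in> Z" for x
    proof -
      have "c x < Suc k"
        using Suc.prems(4) Z(1) that by blast
      moreover have "c x \<noteq> k"
        using Z(4) False that by blast
      ultimately show ?thesis
        by simp
    qed
    then have "c ` Z \<subseteq> {..<k}"
      by blast
    then obtain Z' where "Z' \<subseteq> Z" "Z' \<noteq> {}" "\<forall>r\<in>S. branching Z' d Z' r" "c constant_on Z'"
      using Suc.IH[OF Ultrametric_subspace[OF Z(1)] Z_branch Z(2)] by blast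
    then show ?thesis
      using Z(1) by (meson subset_trans)
  qed
qed

theorem indivisible_if_branching:
  assumes M: "Ultrametric_space M d" "countable M" "M \<noteq> {}"
      "\<And>r. r \<in> distance_set M d \<Longrightarrow> branching M d M r"
    and "reverse_well_ordered (distance_set M d)"
  shows "indivisible M d"
  unfolding indivisible_def
proof (intro allI impI ballI)
  interpret Ultrametric_space M d by fact
  fix k :: nat and c assume "c \<in> M \<rightarrow> {..<k}"
  then have "c ` M \<subseteq> {..<k}"
    by blast
  moreover have "distance_set M d \<subseteq> {0<..}"
    unfolding distance_set_def by (auto simp: mdist_pos_less)
  ultimately obtain Z where Z: "Z \<subseteq> M" "Z \<noteq> {}" "\<forall>r\<in>distance_set M d. branching Z d Z r"
      "c constant_on Z"
    using monochromatic_branching[OF assms(5) _ M(1,4,3)] by metis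
  have "distance_set Z d \<subseteq> distance_set M d"
    using Z(1) unfolding distance_set_def by blast
  then have "isometric Z d M d"
    using Z M by (intro isometric_if_branching[where S = "distance_set M d"] Ultrametric_subspace)
      (auto intro: countable_subset)
  then show "\<exists>Y\<subseteq>M. isometric Y d M d \<and> c constant_on Y"
    using Z by blast
qed

section \<open>The characterisation of indivisibility\<close>

theorem theorem60:
  fixes X :: "'a set" and d :: "'a \<Rightarrow> 'a \<Rightarrow> real" and S :: "real set"
  assumes "Ultrametric_space X d"
    and "X \<noteq> {}"
    and "countable X"
    and "ultrahomogeneous X d"
    and "distance_set X d = S"
    and "S \<subseteq> {0<..}"
  shows "indivisible X d \<longleftrightarrow>
    isometric X d (B_space S) (B_dist S) \<and> reverse_well_ordered S"
proof
  assume ind: "indivisible X d"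
  have branch: "branching X d X r" if "r \<in> S" for r
    using branching_if_indivisible assms(1,4,5) ind that by blast
  have "S \<subseteq> (\<lambda>(x, y). d x y) ` (X \<times> X)"
    using assms(5) unfolding distance_set_def by auto
  then have "countable S"
    using assms(3) by (meson countable_SIGMA countable_image countable_subset)
  then have "isometric X d (B_space S) (B_metric S)"
    using assms branch
    by (intro isometric_if_branching[where S = S] Ultrametric_space_B countable_B_space
        B_space_nonempty distance_set_B branching_B) auto
  then show "isometric X d (B_space S) (B_dist S) \<and> reverse_well_ordered S"
    using reverse_well_ordered_if_indivisible[OF assms(1,4) ind] assms(5)
    by (simp add: isometric_B_metric)
next
  assume B: "isometric X d (B_space S) (B_dist S) \<and> reverse_well_ordered S"
  then have "isometric X d (B_space S) (B_metric S)"
    by (simp add: isometric_B_metric)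
  then have "branching X d X r" if "r \<in> S" for r
    using branching_isometric branching_B that by blast
  then show "indivisible X d"
    using assms B by (intro indivisible_if_branching) auto
qed

end
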